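(* For all integers $n_1,n_2$ with $1\le n_1<n_2\le 4$ we have $\mathcal{C}_4(n_1,n_2)=\mathbb{Z}^+$.
   Context: Orthogonality and the norm $\|\cdot\|$ refer to the standard Euclidean inner product. For positive integers $d,N,n$, $\mathcal{O}_d(N,n)$ denotes the collection of sets $\mathcal{S}\subset\mathbb{Z}^d$ of pairwise orthogonal vectors, each of norm $\sqrt{N}$, with $\#\mathcal{S}=n$. For $1\le n_1<n_2\le d$, \[ \mathcal{C}_d(n_1,n_2)=\big\{N\in\mathbb{Z}^+ : \forall\, \mathcal{S}\in\mathcal{O}_d(N,n_1)\ \exists\, \mathcal{S}'\in\mathcal{O}_d(N,n_2)\text{ with }\mathcal{S}'\supset\mathcal{S}\big\}. \] $\mathbb{Z}^+$ is the set of positive integers. *)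

theory Defs
  imports "HOL-Analysis.Analysis"
begin

text \<open>
  The dimension \<open>d\<close> is the cardinality of the index type \<open>'d\<close>, so \<open>d = 4\<close> is the type \<open>4\<close>.
  \<open>\<int>\<^sup>d\<close> is embedded in \<open>\<real>\<^sup>d\<close>, so that orthogonality and the norm are the Euclidean ones.
\<close>

definition int_vectors :: "(real ^ 'd) set" where
  "int_vectors = {x. \<forall>i. x $ i \<in> \<int>}"

definition orth_sets :: "nat \<Rightarrow> nat \<Rightarrow> (real ^ 'd) set set" where
  "orth_sets N n =
     {S. S \<subseteq> int_vectors \<and> pairwise orthogonal S \<and> (\<forall>x\<in>S. norm x = sqrt (real N)) \<and>
         finite S \<and> card S = n}"

text \<open>
  The argument of type \<open>'d itself\<close> fixes the dimension, which does not occur in the type of the result.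
\<close>

definition extendable :: "'d::finite itself \<Rightarrow> nat \<Rightarrow> nat \<Rightarrow> nat set" where
  "extendable _ n\<^sub>1 n\<^sub>2 =
     {N. N > 0 \<and> (\<forall>S \<in> (orth_sets N n\<^sub>1 :: (real ^ 'd) set set). \<exists>S' \<in> orth_sets N n\<^sub>2. S \<subseteq> S')}"

end

theory Submission imports Defs
begin

text \<open>
  Over the rationals, reflections carry the integral quaternion frame \<open>x, xi, xj, xk\<close> of a member
  \<open>x\<close> of \<open>S\<close> to a rational frame containing \<open>S\<close> (Witt's argument). The columns of a frame satisfy
  the same orthogonality relations as its rows. So if a single vector is missing, its coordinates
  are rational with integral squares, hence integers. If two vectors \<open>z, t\<close> are missing, the Gaussian
  rationals \<open>w\<^sub>i = z\<^sub>i + \<i> t\<^sub>i\<close> have all products \<open>w\<^sub>i cnj w\<^sub>j\<close> in \<open>\<int>[\<i>]\<close>; as \<open>\<int>[\<i>]\<close> is a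
  principal ideal domain, a suitable complex number of modulus 1 multiplies all \<open>w\<^sub>i\<close> into
  \<open>\<int>[\<i>]\<close>, and this rotation of the pair \<open>z, t\<close> makes it integral.
\<close>

section \<open>Gaussian integers and their fractional ideals\<close>

definition gauss_ints :: "complex set" where
  "gauss_ints = {c. Re c \<in> \<int> \<and> Im c \<in> \<int>}"

lemma gauss_ints_closed:
  assumes "a \<in> gauss_ints" "b \<in> gauss_ints"
  shows "a - b \<in> gauss_ints" "a * b \<in> gauss_ints" "cnj a \<in> gauss_ints"
  using assms by (auto simp: gauss_ints_def)

lemma gauss_ints_of_nat [simp]: "of_nat n \<in> gauss_ints"
  by (simp add: gauss_ints_def)

lemma gauss_ints_norm_sq: "c \<in> gauss_ints \<Longrightarrow> (cmod c)\<^sup>2 \<in> \<int>"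
  by (auto simp: gauss_ints_def cmod_power2)

text \<open>Rounding both coordinates leaves a squared distance of at most 1/4 + 1/4; this is
  division with remainder for Gaussian integers.\<close>

lemma gauss_ints_approx:
  obtains q where "q \<in> gauss_ints" "(cmod (c - q))\<^sup>2 < 1"
proof -
  define q where "q = Complex (of_int (round (Re c))) (of_int (round (Im c)))"
  have r: "(x - of_int (round x))\<^sup>2 \<le> 1/4" for x :: real
  proof -
    have "\<bar>x - of_int (round x)\<bar> \<le> 1/2"
      using of_int_round_abs_le[of x] by (simp add: abs_minus_commute)
    then have "\<bar>x - of_int (round x)\<bar>\<^sup>2 \<le> (1/2)\<^sup>2"
      by (intro power_mono) auto
    then show ?thesis by (simp add: power2_eq_square)
  qed
  have "q \<in> gauss_ints" by (simp add: q_def gauss_ints_def)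
  moreover have "(cmod (c - q))\<^sup>2 < 1"
    using r[of "Re c"] r[of "Im c"] by (simp add: q_def cmod_power2)
  ultimately show thesis by (rule that)
qed

text \<open>A nonzero element \<open>g\<close> of least modulus generates: dividing any element by
  \<open>g\<close> leaves a remainder in \<open>I\<close> of smaller modulus, hence 0.\<close>

lemma gauss_fractional_ideal_principal:
  assumes diff: "\<And>a b. a \<in> I \<Longrightarrow> b \<in> I \<Longrightarrow> a - b \<in> I"
    and mult: "\<And>q a. q \<in> gauss_ints \<Longrightarrow> a \<in> I \<Longrightarrow> q * a \<in> I"
    and denom: "D > 0" "\<And>a. a \<in> I \<Longrightarrow> of_nat D * a \<in> gauss_ints"
    and nonzero: "u \<in> I" "u \<noteq> 0"
  obtains g where "g \<in> I" "g \<noteq> 0" "\<And>a. a \<in> I \<Longrightarrow> a / g \<in> gauss_ints"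
proof -
  \<comment> \<open>Clearing the denominator \<open>D\<close> makes the squared modulus an integer
    on \<open>I\<close>, so rounding down loses nothing there and a minimum exists.\<close>
  define f where "f = (\<lambda>a. nat \<lfloor>(cmod (of_nat D * a))\<^sup>2\<rfloor>)"
  have f: "real (f a) = (real D)\<^sup>2 * (cmod a)\<^sup>2" if "a \<in> I" for a
  proof -
    have "(cmod (of_nat D * a))\<^sup>2 \<in> \<int>"
      using denom that gauss_ints_norm_sq by blast
    then obtain k where "(cmod (of_nat D * a))\<^sup>2 = of_int k" by (auto elim: Ints_cases)
    moreover from this have "0 \<le> k"
      by (metis of_int_0_le_iff zero_le_power2)
    ultimately have "real (f a) = (cmod (of_nat D * a))\<^sup>2" by (simp add: f_def)
    then show ?thesis by (simp add: norm_mult power_mult_distrib)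
  qed
  obtain g where g: "g \<in> I" "g \<noteq> 0" "\<And>a. a \<in> I \<Longrightarrow> a \<noteq> 0 \<Longrightarrow> f g \<le> f a"
    using ex_has_least_nat[of "\<lambda>a. a \<in> I \<and> a \<noteq> 0" u f] nonzero by blast
  have "a / g \<in> gauss_ints" if a: "a \<in> I" for a
  proof -
    obtain q where q: "q \<in> gauss_ints" "(cmod (a / g - q))\<^sup>2 < 1"
      by (rule gauss_ints_approx)
    have I: "a - q * g \<in> I" by (intro diff mult a q g)
    have "a - q * g = (a / g - q) * g" using g(2) by (simp add: field_simps)
    then have "(cmod (a - q * g))\<^sup>2 = (cmod (a / g - q))\<^sup>2 * (cmod g)\<^sup>2"
      by (simp add: norm_mult power_mult_distrib)
    also have "\<dots> < (cmod g)\<^sup>2"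
      using q(2) g(2) by simp
    finally have "real (f (a - q * g)) < real (f g)"
      using denom(1) by (simp add: f[OF I] f[OF g(1)])
    then have "a - q * g = 0" using g(3)[OF I] by linarith
    then have "a / g = q" using g(2) by (simp add: field_simps)
    then show ?thesis using q(1) by simp
  qed
  then show thesis using g that by blast
qed

lemma finite_Rats_common_denominator:
  fixes f :: "'a \<Rightarrow> real"
  assumes "finite A" "\<And>x. x \<in> A \<Longrightarrow> f x \<in> \<rat>"
  obtains D :: nat where "D > 0" "\<And>x. x \<in> A \<Longrightarrow> of_nat D * f x \<in> \<int>"
proof -
  have "\<exists>D::nat. D > 0 \<and> (\<forall>x\<in>A. of_nat D * f x \<in> \<int>)"
    using assms
  proof (induction A rule: finite_induct)
    case empty
    then show ?case by (intro exI[of _ 1]) auto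
  next
    case (insert a A)
    then obtain D :: nat where D: "D > 0" "\<forall>x\<in>A. of_nat D * f x \<in> \<int>" by auto
    from insert.prems[of a] obtain k :: int and n :: nat where kn: "n \<noteq> 0" "f a = of_int k / of_nat n"
      by (auto simp: Rats_eq_int_div_nat)
    have "of_nat (n * D) * f x \<in> \<int>" if "x \<in> insert a A" for x
    proof (cases "x = a")
      case True
      have "of_nat (n * D) * f a = of_int (int D * k)" using kn by simp
      then show ?thesis using True by (metis Ints_of_int)
    next
      case False
      then have "of_nat D * f x \<in> \<int>" using D that by auto
      then have "of_nat n * (of_nat D * f x) \<in> \<int>" by (rule Ints_mult[OF Ints_of_nat])
      then show ?thesis by (simp only: of_nat_mult mult.assoc)
    qed
    then show ?case using D kn by (intro exI[of _ "n * D"]) auto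
  qed
  then show thesis using that by blast
qed

lemma unit_multiple_gauss_integral:
  fixes w :: "'i::finite \<Rightarrow> complex"
  assumes rat: "\<And>i. Re (w i) \<in> \<rat>" "\<And>i. Im (w i) \<in> \<rat>"
    and int: "\<And>i j. w i * cnj (w j) \<in> gauss_ints"
  obtains d where "cmod d = 1" "\<And>i. d * w i \<in> gauss_ints"
proof -
  txt \<open>
    \<open>R\<close> is the ideal of common denominators of the \<open>w i\<close>. \<open>I\<close> contains the fractional ideal generated
    by 1 and the \<open>w i\<close>; the second condition holds on generators by \<open>int\<close>. For a generator \<open>g\<close> of \<open>I\<close>,
    \<open>1 / g\<close> lies in \<open>R\<close>, and taking it for \<open>s\<close> shows that \<open>cnj (1 / g) * g\<close>, of modulus 1, makes
    every \<open>cnj (w i)\<close> integral.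
  \<close>
  define R where "R = {s \<in> gauss_ints. \<forall>i. s * w i \<in> gauss_ints}"
  define I where "I = {l. \<forall>s\<in>R. s * l \<in> gauss_ints \<and> (\<forall>j. cnj s * l * cnj (w j) \<in> gauss_ints)}"
  obtain D1 :: nat where D1: "D1 > 0" "\<And>i. of_nat D1 * Re (w i) \<in> \<int>"
    using finite_Rats_common_denominator[of UNIV "\<lambda>i. Re (w i)"] rat by auto
  obtain D2 :: nat where D2: "D2 > 0" "\<And>i. of_nat D2 * Im (w i) \<in> \<int>"
    using finite_Rats_common_denominator[of UNIV "\<lambda>i. Im (w i)"] rat by auto
  define D where "D = D1 * D2"
  have "D > 0" using D1 D2 by (simp add: D_def)
  have DR: "of_nat D \<in> R"
  proof -
    have "real D * Re (w i) \<in> \<int>" for i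
      using Ints_mult[OF Ints_of_nat[of D2] D1(2)[of i]] by (simp add: D_def mult_ac)
    moreover have "real D * Im (w i) \<in> \<int>" for i
      using Ints_mult[OF Ints_of_nat[of D1] D2(2)[of i]] by (simp add: D_def mult_ac)
    ultimately show ?thesis
      unfolding R_def by (auto simp: gauss_ints_def)
  qed
  \<comment> \<open>For \<open>s\<close> in \<open>R\<close>, \<open>cnj s * cnj (w j)\<close> is
    the conjugate of the Gaussian integer \<open>s * w j\<close>.\<close>
  have one: "1 \<in> I"
    unfolding I_def R_def using gauss_ints_closed(3) by fastforce
  have wI: "w i \<in> I" for i
    unfolding I_def R_def
    by (auto simp: mult.assoc intro!: gauss_ints_closed int)
  have diff: "a - b \<in> I" if "a \<in> I" "b \<in> I" for a b
    using that unfolding I_def by (auto simp: algebra_simps intro: gauss_ints_closed)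
  have mult: "q * a \<in> I" if qa: "q \<in> gauss_ints" "a \<in> I" for q a
  proof -
    have "s * (q * a) \<in> gauss_ints" "cnj s * (q * a) * cnj (w j) \<in> gauss_ints" if s: "s \<in> R" for s j
    proof -
      have "q * (s * a) \<in> gauss_ints" "q * (cnj s * a * cnj (w j)) \<in> gauss_ints"
        using qa s unfolding I_def by (blast intro: gauss_ints_closed(2))+
      then show "s * (q * a) \<in> gauss_ints" "cnj s * (q * a) * cnj (w j) \<in> gauss_ints"
        by (simp_all add: mult_ac)
    qed
    then show ?thesis unfolding I_def by blast
  qed
  have denom: "of_nat D * a \<in> gauss_ints" if "a \<in> I" for a
    using that DR unfolding I_def by blast
  obtain g where g: "g \<in> I" "g \<noteq> 0" "\<And>a. a \<in> I \<Longrightarrow> a / g \<in> gauss_ints"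
    using gauss_fractional_ideal_principal[OF diff mult \<open>D > 0\<close> denom one] by auto
  have bR: "1 / g \<in> R"
    using g(3)[OF one] g(3)[OF wI] by (auto simp: R_def)
  \<comment> \<open>The outer conjugation passes from the \<open>cnj (w i)\<close> to the
    \<open>w i\<close> themselves.\<close>
  define d where "d = cnj (cnj (1 / g) * g)"
  have "cnj (1 / g) * g * cnj (w i) \<in> gauss_ints" for i
    using g(1) bR unfolding I_def by blast
  then have "d * w i \<in> gauss_ints" for i
    using gauss_ints_closed(3) unfolding d_def by fastforce
  moreover have "cmod d = 1"
    using g(2) by (simp add: d_def norm_mult norm_divide)
  ultimately show thesis using that by blast
qed

text \<open>In lowest terms the squared denominator divides the squared numerator, so the
  denominator is 1.\<close>

lemma Rats_square_Ints:
  fixes x :: real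
  assumes "x \<in> \<rat>" "x\<^sup>2 \<in> \<int>"
  shows "x \<in> \<int>"
proof -
  obtain m n :: nat where n: "n \<noteq> 0" and x: "\<bar>x\<bar> = real m / real n" and "coprime m n"
    using Rats_abs_nat_div_natE[OF assms(1)] by blast
  obtain k where k: "x\<^sup>2 = of_int k" using assms(2) by (auto elim: Ints_cases)
  have "(real m)\<^sup>2 = of_int k * (real n)\<^sup>2"
    using n x k by (metis nonzero_eq_divide_eq of_nat_eq_0_iff power2_abs power_divide power_not_zero)
  then have "of_int ((int m)\<^sup>2) = (of_int (k * (int n)\<^sup>2) :: real)" by simp
  then have "(int m)\<^sup>2 = k * (int n)\<^sup>2" by (simp only: of_int_eq_iff)
  then have "int n dvd int m"
    by (metis dvd_triv_right pow_divides_pow_iff zero_less_numeral)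
  then have "n = 1" using \<open>coprime m n\<close> by (auto simp: coprime_absorb_right)
  then have "\<bar>x\<bar> \<in> \<int>" using x by simp
  then show ?thesis by (metis Ints_minus abs_if minus_minus)
qed

section \<open>Rational vectors and reflections\<close>

definition rat_vectors :: "(real ^ 'd) set" where
  "rat_vectors = {x. \<forall>i. x $ i \<in> \<rat>}"

lemma int_vectors_subset_rat: "int_vectors \<subseteq> rat_vectors"
  unfolding int_vectors_def rat_vectors_def using Ints_subset_Rats by blast

lemma rat_vectors_inner:
  assumes "x \<in> rat_vectors" "y \<in> rat_vectors"
  shows "x \<bullet> y \<in> \<rat>"
  using assms unfolding rat_vectors_def inner_vec_def by (auto intro!: Rats_sum)

text \<open>The reflection in the hyperplane orthogonal to \<open>v\<close>. For
  \<open>v = 0\<close> it is the identity, as wanted when a vector is to be carried to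
  itself.\<close>

definition reflect :: "'a::real_inner \<Rightarrow> 'a \<Rightarrow> 'a" where
  "reflect v x = x - (2 * (x \<bullet> v) / (v \<bullet> v)) *\<^sub>R v"

lemma reflect_inner: "reflect v x \<bullet> reflect v y = x \<bullet> y"
  by (cases "v = 0") (simp_all add: reflect_def inner_simps inner_commute field_simps)

lemma reflect_orthogonal: "x \<bullet> v = 0 \<Longrightarrow> reflect v x = x"
  by (simp add: reflect_def)

text \<open>Equal norms give \<open>2 * (a \<bullet> (a - b)) = (a - b) \<bullet> (a - b)\<close>,
  so exactly \<open>a - b\<close> is subtracted from \<open>a\<close>.\<close>

lemma reflect_swap:
  assumes "norm a = norm b"
  shows "reflect (a - b) a = b"
proof (cases "a = b")
  case False
  have "a \<bullet> a = b \<bullet> b" using assms by (simp add: dot_square_norm)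
  then have "2 * (a \<bullet> (a - b)) = (a - b) \<bullet> (a - b)"
    by (simp add: inner_simps inner_commute)
  with False show ?thesis by (simp add: reflect_def)
qed (simp add: reflect_def)

lemma reflect_rat_vectors:
  assumes "v \<in> rat_vectors" "x \<in> rat_vectors"
  shows "reflect v x \<in> rat_vectors"
proof -
  have "2 * (x \<bullet> v) / (v \<bullet> v) \<in> \<rat>"
    using assms by (intro Rats_divide Rats_mult rat_vectors_inner) auto
  then show ?thesis
    using assms unfolding reflect_def rat_vectors_def
    by (auto simp del: times_divide_eq_left)
qed

text \<open>Induction on \<open>S\<close>: once a frame contains \<open>S\<close>, a further vector
  \<open>y\<close> is brought in by the rational reflection that carries some frame vector
  \<open>a\<close> outside \<open>S\<close> to \<open>y\<close>. It fixes \<open>S\<close>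
  pointwise, since \<open>a\<close> and \<open>y\<close> are both orthogonal to
  \<open>S\<close>.\<close>

lemma extend_rational_orthogonal:
  fixes S F :: "(real ^ 'd) set"
  assumes "finite S" "S \<subseteq> rat_vectors" "pairwise orthogonal S" "\<forall>x\<in>S. norm x = r"
    and "finite F" "F \<subseteq> rat_vectors" "pairwise orthogonal F" "\<forall>x\<in>F. norm x = r"
    and "card S \<le> card F"
  obtains F' where "S \<subseteq> F'" "finite F'" "card F' = card F" "F' \<subseteq> rat_vectors"
    "pairwise orthogonal F'" "\<forall>x\<in>F'. norm x = r"
proof -
  have "\<exists>F'. S \<subseteq> F' \<and> finite F' \<and> card F' = card F \<and> F' \<subseteq> rat_vectors \<and>
    pairwise orthogonal F' \<and> (\<forall>x\<in>F'. norm x = r)"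
    using assms(1-4,9)
  proof (induction S rule: finite_induct)
    case empty
    then show ?case using assms by blast
  next
    case (insert y S)
    then obtain F' where F': "S \<subseteq> F'" "finite F'" "card F' = card F" "F' \<subseteq> rat_vectors"
      "pairwise orthogonal F'" "\<forall>x\<in>F'. norm x = r"
      by (auto simp: pairwise_insert)
    have "card S < card F'" using insert F' by simp
    then obtain a where a: "a \<in> F'" "a \<notin> S"
      using F' by (metis card_mono finite_subset insert.hyps(1) leD subsetI)
    define R where "R = reflect (a - y)"
    have inner: "R u \<bullet> R v = u \<bullet> v" for u v by (simp add: R_def reflect_inner)
    have norm: "norm (R u) = norm u" for u by (simp add: norm_eq_sqrt_inner inner)
    have inj: "inj R"
    proof (rule injI)
      fix u v assume "R u = R v"
      then have "(u - v) \<bullet> (u - v) = 0"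
        using inner[of u u] inner[of u v] inner[of v u] inner[of v v] by (simp add: inner_diff)
      then show "u = v" by simp
    qed
    have "R a = y"
      unfolding R_def using a F' insert.prems by (intro reflect_swap) simp
    moreover have "R s = s" if "s \<in> S" for s
    proof -
      have "orthogonal s a"
        using F'(1,5) a that by (metis pairwiseD subsetD)
      moreover have "orthogonal s y"
        using insert that by (auto simp: pairwise_insert)
      ultimately show ?thesis
        unfolding R_def by (intro reflect_orthogonal) (simp add: inner_diff orthogonal_def)
    qed
    ultimately have "insert y S \<subseteq> R ` F'"
      using a F'(1) by (metis image_eqI insert_subset subsetD subsetI)
    moreover have "R ` F' \<subseteq> rat_vectors"
    proof -
      have "a - y \<in> rat_vectors"
        using a F' insert.prems unfolding rat_vectors_def by auto
      then show ?thesis unfolding R_def using F' reflect_rat_vectors by blast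
    qed
    moreover have "pairwise orthogonal (R ` F')"
      using F'(5) by (auto simp: pairwise_def orthogonal_def inner)
    moreover have "card (R ` F') = card F"
      using F'(3) inj by (simp add: card_image inj_on_subset)
    ultimately show ?case
      using F' by (intro exI[of _ "R ` F'"]) (auto simp: norm)
  qed
  then show thesis using that by blast
qed

section \<open>Columns of orthogonal frames and the quaternion frame\<close>

text \<open>A square matrix with orthogonal rows of length \<open>r\<close> is \<open>r\<close>
  times an orthogonal matrix. The relation is read off from the expansion of a standard basis vector
  in the basis \<open>F\<close>.\<close>

lemma orthogonal_frame_columns:
  fixes F :: "(real ^ 'd) set"
  assumes "finite F" "card F = CARD('d)" "pairwise orthogonal F" "\<forall>x\<in>F. norm x = r" "r > 0"
  shows "(\<Sum>v\<in>F. v $ i * v $ j) = (if i = j then r\<^sup>2 else 0)"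
proof -
  have "0 \<notin> F" using assms by force
  then have ind: "independent F" using assms pairwise_orthogonal_independent by blast
  have span: "span F = UNIV"
    using ind assms by (metis DIM_cart DIM_real dim_eq_full dim_eq_card_independent mult.right_neutral)
  define x :: "real ^ 'd" where "x = axis i 1"
  \<comment> \<open>\<open>y\<close> is what remains of \<open>x\<close> after subtracting its
    projections onto \<open>F\<close>. It is orthogonal to the spanning set \<open>F\<close>, hence
    to itself, and vanishes.\<close>
  define y where "y = x - (\<Sum>v\<in>F. ((v \<bullet> x) / r\<^sup>2) *\<^sub>R v)"
  have "orthogonal y u" if "u \<in> F" for u
  proof -
    have "(\<Sum>v\<in>F. ((v \<bullet> x) / r\<^sup>2) * (v \<bullet> u)) = (\<Sum>v\<in>F. if v = u then u \<bullet> x else 0)"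
    proof (rule sum.cong)
      fix v assume v: "v \<in> F"
      have "u \<bullet> u = r\<^sup>2" using assms that by (simp add: dot_square_norm)
      moreover have "v \<noteq> u \<Longrightarrow> v \<bullet> u = 0"
        using assms v that by (auto simp: pairwise_def orthogonal_def)
      ultimately show "((v \<bullet> x) / r\<^sup>2) * (v \<bullet> u) = (if v = u then u \<bullet> x else 0)"
        using assms(5) by auto
    qed simp
    also have "\<dots> = x \<bullet> u" using that assms(1) by (simp add: inner_commute)
    finally show ?thesis
      by (simp add: y_def orthogonal_def inner_diff_left inner_sum_left)
  qed
  then have "orthogonal y y"
    using orthogonal_to_span[of y F y] span by (metis UNIV_I)
  then have "y = 0" by (simp add: orthogonal_self)
  then have "x $ j = (\<Sum>v\<in>F. ((v \<bullet> x) / r\<^sup>2) *\<^sub>R v) $ j" by (simp add: y_def)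
  then have "x $ j = (\<Sum>v\<in>F. v $ i * v $ j) / r\<^sup>2"
    by (simp add: x_def inner_axis sum_divide_distrib)
  then show ?thesis using assms(5) by (auto simp: x_def axis_def field_simps split: if_splits)
qed

lemma integer_frame_of_vector:
  fixes x :: "real ^ 4"
  assumes "x \<in> int_vectors" "x \<noteq> 0"
  obtains F where "x \<in> F" "finite F" "card F = 4" "F \<subseteq> int_vectors"
    "pairwise orthogonal F" "\<forall>v\<in>F. norm v = norm x"
proof -
  \<comment> \<open>With coordinates along 1, i, j, k these are the quaternion products of i, j, k
    with \<open>x\<close>, the imaginary unit standing on the left.\<close>
  define a b c :: "real ^ 4" where
    "a = (\<chi> i. if i = 1 then - x $ 2 else if i = 2 then x $ 1 else if i = 3 then - x $ 4 else x $ 3)" and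
    "b = (\<chi> i. if i = 1 then - x $ 3 else if i = 2 then x $ 4 else if i = 3 then x $ 1 else - x $ 2)" and
    "c = (\<chi> i. if i = 1 then - x $ 4 else if i = 2 then - x $ 3 else if i = 3 then x $ 2 else x $ 1)"
  note abc = a_def b_def c_def
  have in0: "x \<bullet> a = 0" "x \<bullet> b = 0" "x \<bullet> c = 0" "a \<bullet> b = 0" "a \<bullet> c = 0" "b \<bullet> c = 0"
    and nrm: "a \<bullet> a = x \<bullet> x" "b \<bullet> b = x \<bullet> x" "c \<bullet> c = x \<bullet> x"
    by (simp_all add: inner_vec_def sum_4 abc)
  have ne: "x \<bullet> x \<noteq> 0" using assms by simp
  have "x \<noteq> a" "x \<noteq> b" "x \<noteq> c" "a \<noteq> b" "a \<noteq> c" "b \<noteq> c"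
    using in0 nrm ne by metis+
  then have "card {x, a, b, c} = 4" by simp
  moreover have "{x, a, b, c} \<subseteq> int_vectors"
    using assms by (auto simp: int_vectors_def forall_4 abc)
  moreover have "pairwise orthogonal {x, a, b, c}"
    using in0 by (auto simp: pairwise_insert orthogonal_def inner_commute)
  moreover have "\<forall>v\<in>{x, a, b, c}. norm v = norm x"
    using nrm by (auto simp: norm_eq_sqrt_inner)
  ultimately show thesis using that[of "{x, a, b, c}"] by simp
qed

section \<open>From rational frames to integral ones\<close>

lemma rotate_pair_integral:
  fixes z t :: "real ^ 'd"
  assumes "z \<in> rat_vectors" "t \<in> rat_vectors"
    and int: "\<And>i j. z $ i * z $ j + t $ i * t $ j \<in> \<int>"
  obtains p q where "p\<^sup>2 + q\<^sup>2 = 1" "p *\<^sub>R z - q *\<^sub>R t \<in> int_vectors" "q *\<^sub>R z + p *\<^sub>R t \<in> int_vectors"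
proof -
  define w where "w = (\<lambda>i. Complex (z $ i) (t $ i))"
  have rat: "z $ i \<in> \<rat>" "t $ i \<in> \<rat>" for i
    using assms by (auto simp: rat_vectors_def)
  have "w i * cnj (w j) \<in> gauss_ints" for i j
  proof -
    txt \<open>The imaginary part is rational, and its square is the squared modulus minus the squared real part.\<close>
    define s where "s = t $ i * z $ j - z $ i * t $ j"
    have "s\<^sup>2 = (z $ i * z $ i + t $ i * t $ i) * (z $ j * z $ j + t $ j * t $ j)
      - (z $ i * z $ j + t $ i * t $ j)\<^sup>2"
      by (simp add: s_def power2_eq_square algebra_simps)
    then have "s\<^sup>2 \<in> \<int>" using int by simp
    moreover have "s \<in> \<rat>" using rat by (simp add: s_def)
    ultimately have "s \<in> \<int>" by (metis Rats_square_Ints)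
    moreover have "Re (w i * cnj (w j)) = z $ i * z $ j + t $ i * t $ j"
      and "Im (w i * cnj (w j)) = s"
      by (simp_all add: w_def s_def)
    ultimately show ?thesis
      using int[of i j] unfolding gauss_ints_def by simp
  qed
  moreover have "Re (w i) \<in> \<rat>" "Im (w i) \<in> \<rat>" for i
    using rat by (simp_all add: w_def)
  ultimately obtain d where d: "cmod d = 1" "\<And>i. d * w i \<in> gauss_ints"
    using unit_multiple_gauss_integral[of w] by blast
  \<comment> \<open>\<open>p\<close> and \<open>q\<close> are the real and imaginary parts of
    \<open>d\<close>; the two new vectors are the real and imaginary parts of
    \<open>d * w i\<close>, taken over all \<open>i\<close>.\<close>
  have "(Re d)\<^sup>2 + (Im d)\<^sup>2 = 1" using d(1) by (metis cmod_power2 one_power2)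
  moreover have "Re d *\<^sub>R z - Im d *\<^sub>R t \<in> int_vectors" "Im d *\<^sub>R z + Re d *\<^sub>R t \<in> int_vectors"
    using d(2) by (simp_all add: int_vectors_def gauss_ints_def w_def add.commute)
  ultimately show thesis by (rule that)
qed

text \<open>In a rational frame \<open>F\<close> around \<open>S\<close>, the column products sum to
  \<open>N\<close> or 0 over \<open>F\<close> and to integers over \<open>S\<close>. Their sums over
  \<open>F - S\<close> are therefore integers, which is what the repair of one or two missing
  vectors starts from.\<close>

lemma integer_frame_extends:
  fixes S :: "(real ^ 4) set"
  assumes S: "S \<subseteq> int_vectors" "pairwise orthogonal S" "\<forall>x\<in>S. norm x = sqrt (real N)" "finite S"
    and N: "N > 0" and card: "1 \<le> card S" "card S \<le> 3"
  obtains F where "S \<subseteq> F" "F \<in> orth_sets N 4"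
proof -
  define r where "r = sqrt (real N)"
  have "r > 0" using N by (simp add: r_def)
  have r2: "r\<^sup>2 = real N" by (simp add: r_def)
  have Sr: "\<forall>x\<in>S. norm x = r" using S by (simp add: r_def)
  obtain x where x: "x \<in> S" using card by fastforce
  have "x \<noteq> 0" using x Sr \<open>r > 0\<close> by force
  then obtain F0 where F0: "x \<in> F0" "finite F0" "card F0 = 4" "F0 \<subseteq> int_vectors"
      "pairwise orthogonal F0" "\<forall>v\<in>F0. norm v = norm x"
    using integer_frame_of_vector x S by blast
  have F0r: "\<forall>v\<in>F0. norm v = r" using F0 x Sr by simp
  obtain F where F: "S \<subseteq> F" "finite F" "card F = card F0" "F \<subseteq> rat_vectors"
    "pairwise orthogonal F" "\<forall>v\<in>F. norm v = r"
    by (rule extend_rational_orthogonal[of S r F0])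
      (use S Sr F0 F0r card int_vectors_subset_rat in auto)
  have "(\<Sum>v\<in>F. v $ i * v $ j) \<in> \<int>" for i j
    using orthogonal_frame_columns[OF F(2) _ F(5,6) \<open>r > 0\<close>, of i j] F F0 r2 by simp
  moreover have "(\<Sum>v\<in>S. v $ i * v $ j) \<in> \<int>" for i j
    using S by (auto simp: int_vectors_def intro!: Ints_sum)
  ultimately have compl: "(\<Sum>v\<in>F - S. v $ i * v $ j) \<in> \<int>" for i j
    using F by (simp add: sum_diff)
  have cardFS: "card (F - S) = 4 - card S"
    using F F0 S by (simp add: card_Diff_subset)
  consider "card S = 1" | "card S = 2" | "card S = 3" using card by linarith
  then show thesis
  proof cases
    \<comment> \<open>With three vectors missing, the quaternion frame \<open>F0\<close> of the
      single given vector is already integral.\<close>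
    case 1
    then have "S = {x}" using x by (metis card_1_singletonE singletonD)
    then show thesis using F0 F0r that[of F0] by (simp add: orth_sets_def r_def)
  next
    case 2
    then obtain z t where zt: "F - S = {z, t}" "z \<noteq> t" using cardFS by (auto simp: card_2_iff)
    then have FS: "F = insert z (insert t S)" "z \<notin> S" "t \<notin> S" using F by auto
    have orth: "z \<bullet> t = 0" "t \<bullet> z = 0" "\<And>s. s \<in> S \<Longrightarrow> z \<bullet> s = 0" "\<And>s. s \<in> S \<Longrightarrow> t \<bullet> s = 0"
      using F(5) zt FS by (auto simp: pairwise_def orthogonal_def)
    have nzt: "z \<bullet> z = r\<^sup>2" "t \<bullet> t = r\<^sup>2" using F(6) FS by (auto simp: dot_square_norm)
    obtain p q where pq: "p\<^sup>2 + q\<^sup>2 = 1" and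
      int: "p *\<^sub>R z - q *\<^sub>R t \<in> int_vectors" "q *\<^sub>R z + p *\<^sub>R t \<in> int_vectors"
      by (rule rotate_pair_integral[of z t]) (use F FS compl zt in auto)
    \<comment> \<open>A rotation in the plane of \<open>z\<close> and \<open>t\<close>: these are
      orthogonal of equal length, so the new pair is too, and it stays orthogonal to
      \<open>S\<close>.\<close>
    define z' t' where "z' = p *\<^sub>R z - q *\<^sub>R t" and "t' = q *\<^sub>R z + p *\<^sub>R t"
    have zt': "z' \<bullet> t' = 0" "\<And>s. s \<in> S \<Longrightarrow> z' \<bullet> s = 0" "\<And>s. s \<in> S \<Longrightarrow> t' \<bullet> s = 0"
      using orth nzt by (simp_all add: z'_def t'_def inner_simps)
    have "z' \<bullet> z' = (p\<^sup>2 + q\<^sup>2) * r\<^sup>2" "t' \<bullet> t' = (p\<^sup>2 + q\<^sup>2) * r\<^sup>2"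
      using orth nzt by (simp_all add: z'_def t'_def inner_simps power2_eq_square algebra_simps)
    then have sq: "z' \<bullet> z' = r\<^sup>2" "t' \<bullet> t' = r\<^sup>2" using pq by simp_all
    have "z' \<noteq> t'" "z' \<notin> S" "t' \<notin> S"
      using zt' sq \<open>r > 0\<close> by fastforce+
    then have "card (insert z' (insert t' S)) = 4" using 2 S by simp
    moreover have "norm z' = r" "norm t' = r" using sq \<open>r > 0\<close> by (simp_all add: norm_eq_sqrt_inner)
    moreover have "pairwise orthogonal (insert z' (insert t' S))"
      using zt' S by (auto simp: pairwise_insert orthogonal_def inner_commute)
    ultimately have "insert z' (insert t' S) \<in> orth_sets N 4"
      using int S by (auto simp: orth_sets_def z'_def t'_def r_def)
    moreover have "S \<subseteq> insert z' (insert t' S)" by blast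
    ultimately show thesis by (intro that)
  next
    case 3
    then obtain t where t: "F - S = {t}" using cardFS by (auto simp: card_1_singleton_iff)
    have "t $ i \<in> \<int>" for i
    proof (rule Rats_square_Ints)
      show "t $ i \<in> \<rat>" using t F by (auto simp: rat_vectors_def)
      show "(t $ i)\<^sup>2 \<in> \<int>" using compl[of i i] t by (simp add: power2_eq_square)
    qed
    then have "t \<in> int_vectors" by (simp add: int_vectors_def)
    then have "F - S \<subseteq> int_vectors" using t by simp
    then have "F \<subseteq> int_vectors" using S(1) by blast
    then have "F \<in> orth_sets N 4" using F F0 by (simp add: orth_sets_def r_def)
    with F(1) show thesis by (rule that)
  qed
qed

theorem theorem5p1:
  fixes n\<^sub>1 n\<^sub>2 :: nat
  assumes "1 \<le> n\<^sub>1" and "n\<^sub>1 < n\<^sub>2" and "n\<^sub>2 \<le> 4"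
  shows "extendable TYPE(4) n\<^sub>1 n\<^sub>2 = {N. N > 0}"
proof -
  have "\<exists>S' \<in> orth_sets N n\<^sub>2. S \<subseteq> S'" if N: "N > 0" and S: "S \<in> orth_sets N n\<^sub>1"
    for N and S :: "(real ^ 4) set"
  proof -
    have S': "S \<subseteq> int_vectors" "pairwise orthogonal S" "\<forall>x\<in>S. norm x = sqrt (real N)"
      "finite S" "card S = n\<^sub>1"
      using S by (auto simp: orth_sets_def)
    \<comment> \<open>A full integral frame around \<open>S\<close> suffices, since its subsets
      containing \<open>S\<close> realise every intermediate size. The lemma applies because
      \<open>n\<^sub>1\<close> is at most 3.\<close>
    obtain F where F: "S \<subseteq> F" "F \<in> orth_sets N 4"
      by (rule integer_frame_extends[OF S'(1-4) N]) (use S' assms in auto)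
    then obtain T where "S \<subseteq> T" "T \<subseteq> F" "card T = n\<^sub>2"
      using exists_subset_between[of S n\<^sub>2 F] S' assms by (auto simp: orth_sets_def)
    moreover from this F have "T \<in> orth_sets N n\<^sub>2"
      by (auto simp: orth_sets_def intro: finite_subset pairwise_subset)
    ultimately show ?thesis by blast
  qed
  then show ?thesis by (auto simp: extendable_def)
qed

end
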